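(* Let $\ell:\mathbb{R}\times\mathcal{G}\times\mathcal{Z}\to\mathbb{R}$ be universally orthogonal with true nuisance parameter $g_0\in\mathcal{G}$. Suppose that $D_g^2\,\mathbb{E}[\partial\ell(\theta,f;Z)\mid X](g-g_0,g-g_0)$ exists for any $f,g\in\mathcal{G}$. Then, for any $g\in\mathcal{G}$ and any $\theta:\mathcal{X}\to\mathbb{R}$, $$\mathrm{Cal}(\theta,g_0)\le \tfrac12\,\mathrm{err}(g,g_0;\theta)+\mathrm{Cal}(\theta,g),$$ where $$\mathrm{err}(g,h;\theta):=\sup_{f\in[g,h]}\sqrt{\mathbb{E}\Big(\big\{D_g^2\,\mathbb{E}[\partial\ell(\theta,f;Z)\mid X](h-g,h-g)\big\}^2\Big)}.$$
   Context: Setting: $Z$ is a random element of a space $\mathcal{Z}$ with distribution $P_Z$; $X$ (covariates, in $\mathcal{X}$) and $W$ (extended variables, in $\mathcal{W}$) are sub-vectors of $Z$, with $X$ a sub-vector of $W$ (written $\mathcal{X}\subset\mathcal{W}\subset\mathcal{Z}$), and $P_X,P_W$ are their marginal laws. $\mathcal{G}\subset L^2(\mathcal{W},P_W)$ is a space of nuisance functions $g:\mathcal{W}\to\mathbb{R}^d$, and $\ell(\nu,g;z)$ is a nuisance-dependent loss with a distinguished true nuisance $g_0\in\mathcal{G}$. Notation: for $\theta:\mathcal{X}\to\mathbb{R}$, $\ell(\theta,g;z)$ abbreviates $\ell(\theta(x),g;z)$, and $\partial\ell(\theta,g;z):=\frac{\partial}{\partial\nu}\ell(\nu,g;z)\big|_{\nu=\theta(x)}$.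 For a functional $T$ on $\mathcal{G}$, $D_gT(f)(h)$ and $D_g^2T(f)(h,h)$ denote the first and second Gateaux derivatives of $T$ at $f$ in direction $h$, i.e. the first and second derivatives in $t$ of $T(f+th)$ at $t=0$. For $f,h\in\mathcal{G}$, $[f,h]:=\{w\mapsto\lambda(w)f(w)+(1-\lambda(w))h(w):\lambda(w)\in[0,1]\}$. $L^2$ calibration error: $\mathrm{Cal}(\theta,g):=\mathbb{E}\big(\mathbb{E}[\partial\ell(\theta,g;Z)\mid\theta(X)]^2\big)^{1/2}$. Universal orthogonality: $\ell$ is universally orthogonal if for any $\theta:\mathcal{X}\to\mathbb{R}$ and $g\in\mathcal{G}$, $D_g\,\mathbb{E}[\partial\ell(\theta,g_0;Z)\mid X](g-g_0)=0$ (the derivative is in the nuisance argument, at $g_0$, in direction $g-g_0$). *)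

theory Defs
  imports "HOL-Probability.Probability"
begin

(* Throughout, PZ is the law of Z, and the sub-vectors X and W of Z are given by measurable maps
   prX and prW on the space of Z. The loss is total in its nuisance argument; G is the nuisance
   space. Values outside G are arbitrary and can enter only where a line t |-> f + t h, along which
   a Gateaux derivative at f in G is taken, leaves G arbitrarily close to f. *)

definition dloss ::
  "(real \<Rightarrow> ('w \<Rightarrow> real ^ 'd) \<Rightarrow> 'z \<Rightarrow> real) \<Rightarrow> ('z \<Rightarrow> 'x) \<Rightarrow>
   ('x \<Rightarrow> real) \<Rightarrow> ('w \<Rightarrow> real ^ 'd) \<Rightarrow> 'z \<Rightarrow> real" where
  "dloss l prX \<theta> g z = deriv (\<lambda>\<nu>. l \<nu> g z) (\<theta> (prX z))"

(* The theta for which the partial derivative of the loss, and hence its conditional expectations,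
   are defined for all nuisances in G. *)
definition admissible ::
  "'z measure \<Rightarrow> 'x measure \<Rightarrow> ('z \<Rightarrow> 'x) \<Rightarrow> (real \<Rightarrow> ('w \<Rightarrow> real ^ 'd) \<Rightarrow> 'z \<Rightarrow> real) \<Rightarrow>
   ('w \<Rightarrow> real ^ 'd) set \<Rightarrow> ('x \<Rightarrow> real) \<Rightarrow> bool" where
  "admissible PZ MX prX l G \<theta> \<longleftrightarrow>
     \<theta> \<in> borel_measurable MX \<and>
     (\<forall>f\<in>G. (AE z in PZ. (\<lambda>\<nu>. l \<nu> f z) field_differentiable at (\<theta> (prX z))) \<and>
            integrable PZ (dloss l prX \<theta> f))"

definition sigma_of :: "'z measure \<Rightarrow> ('z \<Rightarrow> 'b) \<Rightarrow> 'b measure \<Rightarrow> 'z measure" where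
  "sigma_of PZ Y N = vimage_algebra (space PZ) Y N"

(* m \<theta> f x stands for E[dloss(\<theta>, f; Z) | X = x]. Each conditional expectation is only determined
   up to a null set, which may depend on f; to differentiate in f pointwise in x, one version has
   to be selected for every f. The selection m is arbitrary. *)
definition cond_exp_versions ::
  "'z measure \<Rightarrow> 'x measure \<Rightarrow> ('z \<Rightarrow> 'x) \<Rightarrow> (real \<Rightarrow> ('w \<Rightarrow> real ^ 'd) \<Rightarrow> 'z \<Rightarrow> real) \<Rightarrow>
   ('w \<Rightarrow> real ^ 'd) set \<Rightarrow> (('x \<Rightarrow> real) \<Rightarrow> ('w \<Rightarrow> real ^ 'd) \<Rightarrow> 'x \<Rightarrow> real) \<Rightarrow> bool" where
  "cond_exp_versions PZ MX prX l G m \<longleftrightarrow>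
     (\<forall>\<theta>. admissible PZ MX prX l G \<theta> \<longrightarrow>
       (\<forall>f\<in>G. m \<theta> f \<in> borel_measurable MX \<and>
              (AE z in PZ. m \<theta> f (prX z) =
                 real_cond_exp PZ (sigma_of PZ prX MX) (dloss l prX \<theta> f) z)))"

definition shift :: "('w \<Rightarrow> real ^ 'd) \<Rightarrow> ('w \<Rightarrow> real ^ 'd) \<Rightarrow> real \<Rightarrow> 'w \<Rightarrow> real ^ 'd" where
  "shift f h t = (\<lambda>w. f w + t *\<^sub>R h w)"

definition has_gateaux_derivative ::
  "(('w \<Rightarrow> real ^ 'd) \<Rightarrow> real) \<Rightarrow> real \<Rightarrow> ('w \<Rightarrow> real ^ 'd) \<Rightarrow> ('w \<Rightarrow> real ^ 'd) \<Rightarrow> bool" where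
  "has_gateaux_derivative T D f h \<longleftrightarrow> ((\<lambda>t. T (shift f h t)) has_real_derivative D) (at 0)"

definition gateaux2_exists ::
  "(('w \<Rightarrow> real ^ 'd) \<Rightarrow> real) \<Rightarrow> ('w \<Rightarrow> real ^ 'd) \<Rightarrow> ('w \<Rightarrow> real ^ 'd) \<Rightarrow> bool" where
  "gateaux2_exists T f h \<longleftrightarrow>
     (\<forall>\<^sub>F t in nhds 0. (\<lambda>t. T (shift f h t)) field_differentiable at t) \<and>
     deriv (\<lambda>t. T (shift f h t)) field_differentiable at 0"

definition gateaux2 ::
  "(('w \<Rightarrow> real ^ 'd) \<Rightarrow> real) \<Rightarrow> ('w \<Rightarrow> real ^ 'd) \<Rightarrow> ('w \<Rightarrow> real ^ 'd) \<Rightarrow> real" where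
  "gateaux2 T f h = deriv (deriv (\<lambda>t. T (shift f h t))) 0"

definition universally_orthogonal ::
  "'z measure \<Rightarrow> 'x measure \<Rightarrow> ('z \<Rightarrow> 'x) \<Rightarrow> (real \<Rightarrow> ('w \<Rightarrow> real ^ 'd) \<Rightarrow> 'z \<Rightarrow> real) \<Rightarrow>
   ('w \<Rightarrow> real ^ 'd) set \<Rightarrow> (('x \<Rightarrow> real) \<Rightarrow> ('w \<Rightarrow> real ^ 'd) \<Rightarrow> 'x \<Rightarrow> real) \<Rightarrow>
   ('w \<Rightarrow> real ^ 'd) \<Rightarrow> bool" where
  "universally_orthogonal PZ MX prX l G m g0 \<longleftrightarrow>
     (\<forall>\<theta>. admissible PZ MX prX l G \<theta> \<longrightarrow>
       (\<forall>g\<in>G. AE x in distr PZ MX prX. has_gateaux_derivative (\<lambda>f. m \<theta> f x) 0 g0 (g - g0)))"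

(* The weight is required to be measurable, so that interpolants of measurable functions are measurable
   and, for square-integrable endpoints, again square integrable. *)
definition nuisance_interval ::
  "'w measure \<Rightarrow> ('w \<Rightarrow> real ^ 'd) \<Rightarrow> ('w \<Rightarrow> real ^ 'd) \<Rightarrow> ('w \<Rightarrow> real ^ 'd) set" where
  "nuisance_interval MW f h =
     {\<lambda>w. a w *\<^sub>R f w + (1 - a w) *\<^sub>R h w | a. a \<in> borel_measurable MW \<and> (\<forall>w. a w \<in> {0..1})}"

definition L2_functions :: "'w measure \<Rightarrow> ('w \<Rightarrow> real ^ 'd) set" where
  "L2_functions PW = {f. f \<in> borel_measurable PW \<and> integrable PW (\<lambda>w. (norm (f w))\<^sup>2)}"

definition esqrt :: "ennreal \<Rightarrow> ennreal" where
  "esqrt a = (if a = \<top> then \<top> else ennreal (sqrt (enn2real a)))"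

(* Calibration error and nuisance error are [0,\<infinity>]-valued: neither is assumed to be finite. *)
definition Cal ::
  "'z measure \<Rightarrow> ('z \<Rightarrow> 'x) \<Rightarrow> (real \<Rightarrow> ('w \<Rightarrow> real ^ 'd) \<Rightarrow> 'z \<Rightarrow> real) \<Rightarrow>
   ('x \<Rightarrow> real) \<Rightarrow> ('w \<Rightarrow> real ^ 'd) \<Rightarrow> ennreal" where
  "Cal PZ prX l \<theta> g =
     esqrt (\<integral>\<^sup>+ z. ennreal ((real_cond_exp PZ (sigma_of PZ (\<lambda>z. \<theta> (prX z)) borel)
                                 (dloss l prX \<theta> g) z)\<^sup>2) \<partial>PZ)"

definition err ::
  "'x measure \<Rightarrow> 'w measure \<Rightarrow> (('x \<Rightarrow> real) \<Rightarrow> ('w \<Rightarrow> real ^ 'd) \<Rightarrow> 'x \<Rightarrow> real) \<Rightarrow>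
   ('w \<Rightarrow> real ^ 'd) \<Rightarrow> ('w \<Rightarrow> real ^ 'd) \<Rightarrow> ('x \<Rightarrow> real) \<Rightarrow> ennreal" where
  "err PX MW m g h \<theta> =
     (SUP f\<in>nuisance_interval MW g h.
        esqrt (\<integral>\<^sup>+ x. ennreal ((gateaux2 (\<lambda>f'. m \<theta> f' x) f (h - g))\<^sup>2) \<partial>PX))"

(* Existence of the second Gateaux derivative of E[dloss(\<theta>, .; Z) | X] in direction h, at all
   points of G on the line through f. The exceptional null set of x may depend on the line but not
   on the position t: otherwise m \<theta> (shift f h t) x = max (t - x) 0, with X uniform on (0,1), would
   for each t have second derivative 0 at almost every x, while its first derivative jumps. *)
definition cond_gateaux2_exists ::
  "'x measure \<Rightarrow> ('w \<Rightarrow> real ^ 'd) set \<Rightarrow>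
   (('x \<Rightarrow> real) \<Rightarrow> ('w \<Rightarrow> real ^ 'd) \<Rightarrow> 'x \<Rightarrow> real) \<Rightarrow> ('x \<Rightarrow> real) \<Rightarrow>
   ('w \<Rightarrow> real ^ 'd) \<Rightarrow> ('w \<Rightarrow> real ^ 'd) \<Rightarrow> bool" where
  "cond_gateaux2_exists PX G m \<theta> f h \<longleftrightarrow>
     (AE x in PX. \<forall>t. shift f h t \<in> G \<longrightarrow> gateaux2_exists (\<lambda>f'. m \<theta> f' x) (shift f h t) h)"

end

theory Submission
  imports Defs
begin

text \<open>Put \<open>\<phi> t x = m \<theta> (g0 + t (g - g0)) x\<close>. Orthogonality kills the first-order
  term, so \<open>\<phi> 1 x - \<phi> 0 x\<close> is the integral of \<open>(1 - t) \<phi>'' t x\<close> over \<open>[0,1]\<close>. By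
  Cauchy--Schwarz in \<open>t\<close> and Tonelli, its \<open>L\<^sup>2\<close> norm is at most half the supremum over \<open>t\<close>
  of the \<open>L\<^sup>2\<close> norm of \<open>\<phi>'' t\<close>. Conditioning on \<open>\<theta>(X)\<close> contracts \<open>L\<^sup>2\<close>, and the
  triangle inequality concludes. The Lagrange form of the remainder would require an intermediate
  point depending on \<open>x\<close>, which the arbitrary selection \<open>m\<close> of versions does not permit; with
  the integral form, interpolation weights that are constant in \<open>w\<close> suffice.\<close>

section \<open>Square roots and Minkowski's inequality in [0,\<infinity>]\<close>

text \<open>The identity includes the value \<infinity>, so \<open>L^2\<close> bounds can be proved
  in squared form and converted back without any finiteness assumption.\<close>

lemma esqrt_power2: "(esqrt a)\<^sup>2 = a"
  by (cases a) (auto simp: esqrt_def ennreal_power ennreal_top_mult power2_eq_square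
      simp flip: ennreal_mult)

lemma ennreal_power2_le_iff: "a\<^sup>2 \<le> b\<^sup>2 \<longleftrightarrow> a \<le> (b :: ennreal)"
proof
  assume le: "a\<^sup>2 \<le> b\<^sup>2"
  show "a \<le> b"
  proof (cases b)
    case (real r)
    with le obtain s where "a = ennreal s" "s \<ge> 0"
      by (cases a) (auto simp: power2_eq_square ennreal_top_mult top_unique simp flip: ennreal_mult)
    with real le show ?thesis
      by (auto simp: ennreal_power intro: power2_le_imp_le)
  qed auto
qed (rule power_mono, auto)

lemma esqrt_le_iff: "esqrt a \<le> b \<longleftrightarrow> a \<le> b\<^sup>2"
  using ennreal_power2_le_iff[of "esqrt a" b] by (simp add: esqrt_power2)

text \<open>Expand the square and bound the cross term by Cauchy-Schwarz. Both sides may be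
  infinite, as calibration and nuisance errors may be.\<close>

lemma Minkowski_nn_integral_esqrt:
  fixes f g :: "'a \<Rightarrow> ennreal"
  assumes [measurable]: "f \<in> borel_measurable M" "g \<in> borel_measurable M"
  shows "esqrt (\<integral>\<^sup>+x. (f x + g x)\<^sup>2 \<partial>M) \<le> esqrt (\<integral>\<^sup>+x. (f x)\<^sup>2 \<partial>M) + esqrt (\<integral>\<^sup>+x. (g x)\<^sup>2 \<partial>M)"
    (is "_ \<le> ?A + ?B")
proof -
  have "(\<integral>\<^sup>+x. f x * g x \<partial>M)\<^sup>2 \<le> (?A * ?B)\<^sup>2"
    using Cauchy_Schwarz_nn_integral[of f M g] by (simp add: power_mult_distrib esqrt_power2)
  then have fg: "(\<integral>\<^sup>+x. f x * g x \<partial>M) \<le> ?A * ?B"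
    by (simp add: ennreal_power2_le_iff)
  have "(\<integral>\<^sup>+x. (f x + g x)\<^sup>2 \<partial>M) = (\<integral>\<^sup>+x. (f x)\<^sup>2 + (g x)\<^sup>2 + 2 * (f x * g x) \<partial>M)"
    by (intro nn_integral_cong) (simp add: power2_sum mult.assoc)
  also have "\<dots> = (\<integral>\<^sup>+x. (f x)\<^sup>2 \<partial>M) + (\<integral>\<^sup>+x. (g x)\<^sup>2 \<partial>M) + 2 * (\<integral>\<^sup>+x. f x * g x \<partial>M)"
    by (simp add: nn_integral_add nn_integral_cmult)
  also have "\<dots> \<le> ?A\<^sup>2 + ?B\<^sup>2 + 2 * (?A * ?B)"
    using fg by (simp add: esqrt_power2 add_left_mono mult_left_mono)
  also have "\<dots> = (?A + ?B)\<^sup>2"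
    by (simp add: power2_sum mult.assoc)
  finally show ?thesis
    by (simp add: esqrt_le_iff)
qed

section \<open>Squared Taylor remainder on the unit interval\<close>

text \<open>\<open>I\<close> is a Henstock-Kurzweil integral. If \<open>\<bar>f\<bar>\<close> has
  finite integral, then \<open>f\<close> is Lebesgue integrable with the same integral, and the
  usual bound applies; otherwise the right-hand side is infinite.\<close>

lemma has_integral_le_nn_integral_abs:
  fixes f :: "real \<Rightarrow> real"
  assumes I: "(f has_integral I) UNIV" and [measurable]: "f \<in> borel_measurable borel"
  shows "ennreal \<bar>I\<bar> \<le> (\<integral>\<^sup>+x. ennreal \<bar>f x\<bar> \<partial>lborel)"
proof (cases "(\<integral>\<^sup>+x. ennreal \<bar>f x\<bar> \<partial>lborel) = \<infinity>")
  case False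
  then have int: "integrable lborel f"
    by (auto simp: integrable_iff_bounded top.not_eq_extremum)
  have "I = (\<integral>x. f x \<partial>lborel)"
    using has_integral_integral_lborel[OF int] I by (rule has_integral_unique[symmetric])
  then show ?thesis
    using integral_norm_bound_ennreal[OF int] by simp
qed simp

text \<open>Total mass of the Taylor weight. It enters twice, once from Cauchy-Schwarz and once
  after Tonelli, which produces 1/4 for squares and hence 1/2 for norms.\<close>

lemma nn_integral_indicator_one_minus:
  "(\<integral>\<^sup>+t. ennreal ((1 - t) * indicator {0<..<1} t) \<partial>lborel) = ennreal (1/2 :: real)"
proof (rule nn_integral_has_integral_lborel)
  have "((\<lambda>t::real. 1 - t) has_integral ((1 - 1\<^sup>2 / 2) - (0 - 0\<^sup>2 / 2))) {0..1}"
    by (rule fundamental_theorem_of_calculus)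
      (auto intro!: derivative_eq_intros simp flip: has_real_derivative_iff_has_vector_derivative)
  then have "((\<lambda>t::real. (1 - t) * indicator {0<..<1} t) has_integral 1/2) {0..1}"
    using has_integral_spike_finite[of "{0, 1}" "{0..1}" "\<lambda>t::real. (1 - t) * indicator {0<..<1} t" "\<lambda>t. 1 - t"]
    by simp
  then show "((\<lambda>t::real. (1 - t) * indicator {0<..<1} t) has_integral 1/2) UNIV"
    by (rule has_integral_on_superset) auto
qed (auto split: split_indicator)

text \<open>The second derivative is only assumed to exist, so it need not be Lebesgue integrable; the
  remainder is represented by a Henstock--Kurzweil integral, and if that integral is not absolutely
  convergent then the right-hand side is infinite.\<close>

lemma taylor2_remainder_le_nn_integral:
  fixes f f' f'' :: "real \<Rightarrow> real"
  assumes f: "\<And>t. t \<in> {0..1} \<Longrightarrow> (f has_real_derivative f' t) (at t)"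
    and f': "\<And>t. t \<in> {0..1} \<Longrightarrow> (f' has_real_derivative f'' t) (at t)"
    and "f' 0 = 0"
    and [measurable]: "(\<lambda>t. indicator {0<..<1} t * f'' t) \<in> borel_measurable borel"
  shows "ennreal ((f 1 - f 0)\<^sup>2) \<le>
    ennreal (1/2) * (\<integral>\<^sup>+t. ennreal ((1 - t) * indicator {0<..<1} t) *
                           ennreal ((indicator {0<..<1} t * f'' t)\<^sup>2) \<partial>lborel)"
proof -
  define w where "w t = (1 - t) * indicator {0<..<1} t" for t :: real
  define D where "D t = indicator {0<..<1} t * f'' t" for t
  have [measurable]: "w \<in> borel_measurable borel" "D \<in> borel_measurable borel"
    unfolding w_def D_def by measurable
  have w_nonneg: "0 \<le> w t" for t
    by (simp add: w_def split: split_indicator)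
  \<comment> \<open>In the derivative of this function the terms \<open>f' t\<close> and
    \<open>- f' t\<close> cancel. Its increment over [0,1] is \<open>f 1 - f 0 - f' 0\<close>, where
    \<open>f' 0 = 0\<close>.\<close>
  have "((\<lambda>t. f t + (1 - t) * f' t) has_real_derivative (1 - t) * f'' t) (at t)" if "t \<in> {0..1}" for t
    using f[OF that] f'[OF that] by (auto intro!: derivative_eq_intros)
  then have "((\<lambda>t. (1 - t) * f'' t) has_integral (f 1 + (1 - 1) * f' 1) - (f 0 + (1 - 0) * f' 0)) {0..1}"
    by (intro fundamental_theorem_of_calculus)
      (auto simp flip: has_real_derivative_iff_has_vector_derivative
        intro: has_field_derivative_at_within)
  \<comment> \<open>The indicators of the open interval change the integrand at most at 0 and
    1.\<close>
  then have "((\<lambda>t. w t * D t) has_integral f 1 - f 0) {0..1}"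
    using \<open>f' 0 = 0\<close>
      has_integral_spike_finite[of "{0, 1}" "{0..1}" "\<lambda>t. w t * D t" "\<lambda>t. (1 - t) * f'' t"]
    by (simp add: w_def D_def)
  then have "((\<lambda>t. w t * D t) has_integral f 1 - f 0) UNIV"
    by (rule has_integral_on_superset) (auto simp: w_def)
  then have "ennreal \<bar>f 1 - f 0\<bar> \<le> (\<integral>\<^sup>+t. ennreal \<bar>w t * D t\<bar> \<partial>lborel)"
    by (rule has_integral_le_nn_integral_abs) measurable
  \<comment> \<open>Splitting the weight evenly makes Cauchy-Schwarz yield its mass 1/2 times the
    weighted integral of \<open>(D t)\<^sup>2\<close>.\<close>
  also have "\<dots> = (\<integral>\<^sup>+t. ennreal (sqrt (w t)) * ennreal (sqrt (w t) * \<bar>D t\<bar>) \<partial>lborel)"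
    using w_nonneg
    by (intro nn_integral_cong) (simp add: abs_mult flip: ennreal_mult mult.assoc)
  finally have "(ennreal \<bar>f 1 - f 0\<bar>)\<^sup>2 \<le> \<dots>\<^sup>2"
    by (rule power_mono) simp
  also have "\<dots> \<le> (\<integral>\<^sup>+t. (ennreal (sqrt (w t)))\<^sup>2 \<partial>lborel) *
                   (\<integral>\<^sup>+t. (ennreal (sqrt (w t) * \<bar>D t\<bar>))\<^sup>2 \<partial>lborel)"
    by (rule Cauchy_Schwarz_nn_integral) measurable
  also have "(\<integral>\<^sup>+t. (ennreal (sqrt (w t)))\<^sup>2 \<partial>lborel) = ennreal (1/2)"
    using w_nonneg nn_integral_indicator_one_minus by (simp add: ennreal_power w_def)
  also have "(\<integral>\<^sup>+t. (ennreal (sqrt (w t) * \<bar>D t\<bar>))\<^sup>2 \<partial>lborel) =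
             (\<integral>\<^sup>+t. ennreal (w t) * ennreal ((D t)\<^sup>2) \<partial>lborel)"
    using w_nonneg
    by (intro nn_integral_cong) (simp add: ennreal_power power_mult_distrib ennreal_mult)
  finally show ?thesis
    by (simp add: ennreal_power w_def D_def)
qed

section \<open>Joint measurability of functions and their partial derivatives\<close>

lemma floor_grid_tendsto: "(\<lambda>k. of_int \<lfloor>real (Suc k) * t\<rfloor> / real (Suc k)) \<longlonglongrightarrow> t"
proof (rule real_tendsto_sandwich)
  show "\<forall>\<^sub>F k in sequentially. t - 1 / real (Suc k) \<le> of_int \<lfloor>real (Suc k) * t\<rfloor> / real (Suc k)"
  proof (intro always_eventually allI)
    fix k
    have "real (Suc k) * t - 1 \<le> of_int \<lfloor>real (Suc k) * t\<rfloor>" by linarith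
    then have "(real (Suc k) * t - 1) / real (Suc k) \<le> of_int \<lfloor>real (Suc k) * t\<rfloor> / real (Suc k)"
      by (rule divide_right_mono) simp
    then show "t - 1 / real (Suc k) \<le> of_int \<lfloor>real (Suc k) * t\<rfloor> / real (Suc k)"
      by (simp add: diff_divide_distrib)
  qed
  show "\<forall>\<^sub>F k in sequentially. of_int \<lfloor>real (Suc k) * t\<rfloor> / real (Suc k) \<le> t"
  proof (intro always_eventually allI)
    fix k
    have "of_int \<lfloor>real (Suc k) * t\<rfloor> \<le> real (Suc k) * t" by linarith
    then show "of_int \<lfloor>real (Suc k) * t\<rfloor> / real (Suc k) \<le> t"
      by (subst pos_divide_le_eq) (simp_all add: mult.commute)
  qed
  show "(\<lambda>k. t - 1 / real (Suc k)) \<longlonglongrightarrow> t"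
    using tendsto_diff[OF tendsto_const LIMSEQ_Suc[OF lim_1_over_n], of t] by simp
qed simp

text \<open>Round the parameter down to a grid of mesh \<open>1 / (k + 1)\<close>; by continuity the
  rounded functions converge to the given one. Measurability of \<open>f t\<close> is required for
  all \<open>t\<close>, because grid points may lie outside \<open>S\<close>.\<close>

lemma borel_measurable_Caratheodory:
  fixes f :: "real \<Rightarrow> 'a \<Rightarrow> real"
  assumes f[measurable]: "\<And>t. f t \<in> borel_measurable M"
    and [measurable]: "S \<in> sets borel" "A \<in> sets M"
    and cont: "\<And>t x. t \<in> S \<Longrightarrow> x \<in> A \<Longrightarrow> isCont (\<lambda>s. f s x) t"
  shows "(\<lambda>p. indicator S (fst p) * indicator A (snd p) * f (fst p) (snd p))
           \<in> borel_measurable (borel \<Otimes>\<^sub>M M)"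
proof (rule borel_measurable_LIMSEQ_real)
  fix p :: "real \<times> 'a"
  show "(\<lambda>k. indicator S (fst p) * indicator A (snd p) *
             f (of_int \<lfloor>real (Suc k) * fst p\<rfloor> / real (Suc k)) (snd p))
        \<longlonglongrightarrow> indicator S (fst p) * indicator A (snd p) * f (fst p) (snd p)"
  proof (cases "fst p \<in> S \<and> snd p \<in> A")
    case True
    then have "isCont (\<lambda>s. f s (snd p)) (fst p)" by (intro cont) auto
    from isCont_tendsto_compose[OF this floor_grid_tendsto] show ?thesis
      by (intro tendsto_mult tendsto_const)
  qed (auto simp: indicator_def)
next
  fix k
  \<comment> \<open>The rounded parameter takes only countably many values, and for each of them the
    function is measurable in the second coordinate.\<close>
  have [measurable]: "(\<lambda>p. f (of_int \<lfloor>real (Suc k) * fst p\<rfloor> / real (Suc k)) (snd p))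
      \<in> borel_measurable (borel \<Otimes>\<^sub>M M)"
    by (rule measurable_compose_countable[where f = "\<lambda>i p. f (of_int i / real (Suc k)) (snd p)"])
      measurable
  show "(\<lambda>p. indicator S (fst p) * indicator A (snd p) *
             f (of_int \<lfloor>real (Suc k) * fst p\<rfloor> / real (Suc k)) (snd p))
        \<in> borel_measurable (borel \<Otimes>\<^sub>M M)"
    by measurable
qed

text \<open>The derivative is the limit of difference quotients with step
  \<open>1 / (k + 1)\<close>. The cut-off by indicators does not disturb the limit: \<open>S\<close>
  is open, so the shifted point eventually stays in \<open>S\<close>.\<close>

lemma borel_measurable_partial_derivative:
  fixes f f' :: "real \<Rightarrow> 'a \<Rightarrow> real"
  assumes f: "(\<lambda>p. indicator S (fst p) * indicator A (snd p) * f (fst p) (snd p))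
                \<in> borel_measurable (borel \<Otimes>\<^sub>M M)"
    and S: "open S" and [measurable]: "A \<in> sets M"
    and deriv: "\<And>t x. t \<in> S \<Longrightarrow> x \<in> A \<Longrightarrow> ((\<lambda>s. f s x) has_real_derivative f' t x) (at t)"
  shows "(\<lambda>p. indicator S (fst p) * indicator A (snd p) * f' (fst p) (snd p))
           \<in> borel_measurable (borel \<Otimes>\<^sub>M M)"
proof (rule borel_measurable_LIMSEQ_real)
  have [measurable]: "S \<in> sets borel" using S by simp
  define F where "F p = indicator S (fst p) * indicator A (snd p) * f (fst p) (snd p)" for p
  have F[measurable]: "F \<in> borel_measurable (borel \<Otimes>\<^sub>M M)"
    using f unfolding F_def .
  define Q where "Q k p = indicator S (fst p) * indicator A (snd p) *
      ((F (fst p + inverse (real (Suc k)), snd p) - F p) / inverse (real (Suc k)))" for k p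
  show "Q k \<in> borel_measurable (borel \<Otimes>\<^sub>M M)" for k
    unfolding Q_def by measurable
  fix p :: "real \<times> 'a"
  show "(\<lambda>k. Q k p) \<longlonglongrightarrow> indicator S (fst p) * indicator A (snd p) * f' (fst p) (snd p)"
  proof (cases "fst p \<in> S \<and> snd p \<in> A")
    case True
    have "((\<lambda>s. F (s, snd p)) has_real_derivative f' (fst p) (snd p)) (at (fst p))"
      by (rule has_field_derivative_transform_within_open[OF deriv S])
        (use True in \<open>auto simp: F_def\<close>)
    then have lim: "((\<lambda>h. (F (fst p + h, snd p) - F (fst p, snd p)) / h) \<longlongrightarrow> f' (fst p) (snd p)) (at 0)"
      by (simp add: DERIV_def)
    have "filterlim (\<lambda>k. inverse (real (Suc k))) (at 0) sequentially"
      using LIMSEQ_inverse_real_of_nat by (auto simp: filterlim_at intro!: always_eventually)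
    from filterlim_compose[OF lim this] True show ?thesis
      by (simp add: Q_def)
  qed (auto simp: Q_def indicator_def)
qed

section \<open>From second derivatives to the mean square increment\<close>

text \<open>For almost every \<open>x\<close> the squared increment is at most 1/2 times the
  integral of \<open>(1 - t) * (\<phi>'' t x)\<^sup>2\<close>. After Tonelli each integral over
  \<open>x\<close> is at most \<open>C\<close>, and the weight contributes another 1/2. Only
  measurability in \<open>x\<close> is assumed; the joint measurability that Tonelli needs comes
  from differentiability in \<open>t\<close>.\<close>

lemma nn_integral_increment_le_second_derivative:
  fixes \<phi> \<phi>' \<phi>'' :: "real \<Rightarrow> 'a \<Rightarrow> real"
  assumes "sigma_finite_measure M"
    and meas: "\<And>t. t \<in> {0..1} \<Longrightarrow> \<phi> t \<in> borel_measurable M"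
    and reg: "AE x in M. \<phi>' 0 x = 0 \<and>
        (\<forall>t\<in>{0..1}. ((\<lambda>s. \<phi> s x) has_real_derivative \<phi>' t x) (at t) \<and>
                     ((\<lambda>s. \<phi>' s x) has_real_derivative \<phi>'' t x) (at t))"
    and bound: "\<And>t. t \<in> {0..1} \<Longrightarrow> (\<integral>\<^sup>+x. ennreal ((\<phi>'' t x)\<^sup>2) \<partial>M) \<le> C"
  shows "(\<integral>\<^sup>+x. ennreal ((\<phi> 1 x - \<phi> 0 x)\<^sup>2) \<partial>M) \<le> ennreal (1/4) * C"
proof -
  interpret M: sigma_finite_measure M by fact
  interpret pair_sigma_finite lborel M
    by (intro pair_sigma_finite.intro M.sigma_finite_measure_axioms lborel.sigma_finite_measure_axioms)
  obtain N where N: "N \<in> null_sets M" and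
    good: "\<And>x. x \<in> space M - N \<Longrightarrow> \<phi>' 0 x = 0 \<and>
        (\<forall>t\<in>{0..1}. ((\<lambda>s. \<phi> s x) has_real_derivative \<phi>' t x) (at t) \<and>
                     ((\<lambda>s. \<phi>' s x) has_real_derivative \<phi>'' t x) (at t))"
    using AE_E3[OF reg] by metis
  define A where "A = space M - N"
  have A[measurable]: "A \<in> sets M" using N by (auto simp: A_def)
  have AE_A: "AE x in M. x \<in> A" using AE_not_in[OF N] by (auto simp: A_def)
  define S where "S = {0<..<1::real}"
  have S: "open S" and S_sub: "\<And>t. t \<in> S \<Longrightarrow> t \<in> {0..1}" by (auto simp: S_def)
  \<comment> \<open>\<open>\<phi> t\<close> is known to be measurable only for \<open>t\<close> in
    [0,1], whereas the approximation on a grid needs every \<open>t\<close>; hence the extension by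
    0.\<close>
  define \<psi> where "\<psi> t x = (if t \<in> S then \<phi> t x else 0)" for t x
  have \<psi>: "((\<lambda>s. \<psi> s x) has_real_derivative \<phi>' t x) (at t)" if "t \<in> S" "x \<in> A" for t x
    by (rule has_field_derivative_transform_within_open[OF _ S, of "\<lambda>s. \<phi> s x"])
      (use that good[of x] S_sub in \<open>auto simp: \<psi>_def A_def\<close>)
  define D where "D t x = indicator S t * indicator A x * \<phi>'' t x" for t x
  have "(\<lambda>p. indicator S (fst p) * indicator A (snd p) * \<psi> (fst p) (snd p))
      \<in> borel_measurable (borel \<Otimes>\<^sub>M M)"
  proof (rule borel_measurable_Caratheodory)
    show "\<psi> t \<in> borel_measurable M" for t
      using meas[OF S_sub, of t] by (cases "t \<in> S") (simp_all add: \<psi>_def[abs_def])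
    show "isCont (\<lambda>s. \<psi> s x) t" if "t \<in> S" "x \<in> A" for t x
      using \<psi>[OF that] by (rule DERIV_isCont)
  qed (use S in simp_all)
  \<comment> \<open>Joint measurability passes from \<open>\<psi>\<close> to \<open>\<phi>'\<close>,
    and by a second application to \<open>\<phi>''\<close>, each cut off to \<open>S\<close> and
    \<open>A\<close>.\<close>
  from borel_measurable_partial_derivative[OF this S A \<psi>]
  have "(\<lambda>p. indicator S (fst p) * indicator A (snd p) * \<phi>' (fst p) (snd p))
      \<in> borel_measurable (borel \<Otimes>\<^sub>M M)" by simp
  from borel_measurable_partial_derivative[OF this S A, of \<phi>'']
  have D[measurable]: "(\<lambda>p. D (fst p) (snd p)) \<in> borel_measurable (borel \<Otimes>\<^sub>M M)"
    using good S_sub by (auto simp: A_def D_def)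
  have D'[measurable]: "(\<lambda>p. D (fst p) (snd p)) \<in> borel_measurable (lborel \<Otimes>\<^sub>M M)"
    using D by (simp cong: measurable_cong_sets sets_pair_measure_cong)
  have [measurable]: "(\<lambda>p. D (snd p) (fst p)) \<in> borel_measurable (M \<Otimes>\<^sub>M lborel)"
    using measurable_pair_swap[OF D'] by (simp add: split_beta')
  have [measurable]: "S \<in> sets borel" using S by simp
  have "AE x in M. ennreal ((\<phi> 1 x - \<phi> 0 x)\<^sup>2) \<le>
    ennreal (1/2) * (\<integral>\<^sup>+t. ennreal ((1 - t) * indicator S t) * ennreal ((D t x)\<^sup>2) \<partial>lborel)"
    using AE_A
  proof eventually_elim
    case (elim x)
    have Dx: "D t x = indicator S t * \<phi>'' t x" for t
      using elim by (simp add: D_def)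
    have "(\<lambda>t. D (fst (t, x)) (snd (t, x))) \<in> borel_measurable borel"
      using elim sets.sets_into_space[OF A] by (intro measurable_compose[OF _ D]) auto
    then show ?case
      unfolding Dx using elim good[of x]
      by (intro taylor2_remainder_le_nn_integral[of "\<lambda>t. \<phi> t x" "\<lambda>t. \<phi>' t x" "\<lambda>t. \<phi>'' t x", folded S_def])
        (auto simp: A_def Dx)
  qed
  then have "(\<integral>\<^sup>+x. ennreal ((\<phi> 1 x - \<phi> 0 x)\<^sup>2) \<partial>M) \<le>
    (\<integral>\<^sup>+x. ennreal (1/2) * (\<integral>\<^sup>+t. ennreal ((1 - t) * indicator S t) * ennreal ((D t x)\<^sup>2) \<partial>lborel) \<partial>M)"
    by (rule nn_integral_mono_AE)
  also have "\<dots> = ennreal (1/2) *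
    (\<integral>\<^sup>+x. (\<integral>\<^sup>+t. ennreal ((1 - t) * indicator S t) * ennreal ((D t x)\<^sup>2) \<partial>lborel) \<partial>M)"
    by (intro nn_integral_cmult borel_measurable_nn_integral lborel.borel_measurable_nn_integral)
      (simp add: split_beta')
  also have "(\<integral>\<^sup>+x. (\<integral>\<^sup>+t. ennreal ((1 - t) * indicator S t) * ennreal ((D t x)\<^sup>2) \<partial>lborel) \<partial>M) =
    (\<integral>\<^sup>+t. (\<integral>\<^sup>+x. ennreal ((1 - t) * indicator S t) * ennreal ((D t x)\<^sup>2) \<partial>M) \<partial>lborel)"
    by (intro Fubini') (simp add: split_beta')
  also have "\<dots> \<le> (\<integral>\<^sup>+t. ennreal ((1 - t) * indicator S t) * C \<partial>lborel)"
  proof (rule nn_integral_mono)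
    fix t :: real
    show "(\<integral>\<^sup>+x. ennreal ((1 - t) * indicator S t) * ennreal ((D t x)\<^sup>2) \<partial>M)
        \<le> ennreal ((1 - t) * indicator S t) * C"
    proof (cases "t \<in> S")
      case True
      have [measurable]: "D t \<in> borel_measurable M"
        using measurable_compose[OF measurable_Pair1' D', of t] by simp
      \<comment> \<open>For \<open>t\<close> in \<open>S\<close> the cut-off \<open>D t\<close>
        differs from \<open>\<phi>'' t\<close> only on the exceptional null set.\<close>
      have "(\<integral>\<^sup>+x. ennreal ((D t x)\<^sup>2) \<partial>M) = (\<integral>\<^sup>+x. ennreal ((\<phi>'' t x)\<^sup>2) \<partial>M)"
        using AE_A True by (intro nn_integral_cong_AE) (auto elim!: eventually_mono simp: D_def)
      with bound[OF S_sub[OF True]] show ?thesis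
        by (simp add: nn_integral_cmult mult_left_mono)
    qed simp
  qed
  also have "\<dots> = ennreal (1/2) * C"
    using nn_integral_indicator_one_minus S by (subst nn_integral_multc) (auto simp: S_def)
  also have "ennreal (1/2) * (ennreal (1/2) * C) = ennreal (1/4) * C"
    by (subst mult.assoc[symmetric], subst ennreal_mult[symmetric]) auto
  finally show ?thesis
    by (simp add: mult_left_mono)
qed

section \<open>Conditioning and the calibration error\<close>

text \<open>Conditional Jensen for the square when \<open>u\<close> is square integrable; otherwise
  the right-hand side is infinite.\<close>

lemma (in sigma_finite_subalgebra) nn_integral_real_cond_exp_power2_le:
  fixes u :: "'a \<Rightarrow> real"
  assumes u: "integrable M u"
  shows "(\<integral>\<^sup>+x. ennreal ((real_cond_exp M F u x)\<^sup>2) \<partial>M) \<le> (\<integral>\<^sup>+x. ennreal ((u x)\<^sup>2) \<partial>M)"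
proof (cases "(\<integral>\<^sup>+x. ennreal ((u x)\<^sup>2) \<partial>M) = \<infinity>")
  case False
  then have u2: "integrable M (\<lambda>x. (u x)\<^sup>2)"
    using u by (auto simp: integrable_iff_bounded top.not_eq_extremum)
  have "AE x in M. (real_cond_exp M F u x)\<^sup>2 \<le> real_cond_exp M F (\<lambda>x. (u x)\<^sup>2) x"
    by (rule real_cond_exp_jensens_inequality(2)[OF u, of UNIV])
      (use u2 in \<open>auto intro: convex_power2\<close>)
  then have ae: "AE x in M. ennreal ((real_cond_exp M F u x)\<^sup>2) \<le> ennreal (real_cond_exp M F (\<lambda>x. (u x)\<^sup>2) x)"
    by eventually_elim (rule ennreal_leI)
  have "(\<integral>\<^sup>+x. ennreal ((real_cond_exp M F u x)\<^sup>2) \<partial>M) \<le> (\<integral>\<^sup>+x. ennreal (real_cond_exp M F (\<lambda>x. (u x)\<^sup>2) x) \<partial>M)"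
    using ae by (rule nn_integral_mono_AE)
  also have "\<dots> = ennreal (\<integral>x. (u x)\<^sup>2 \<partial>M)"
    using real_cond_exp_int[OF u2] real_cond_exp_pos[of "\<lambda>x. (u x)\<^sup>2"] u2
    by (subst nn_integral_eq_integral) auto
  also have "\<dots> = (\<integral>\<^sup>+x. ennreal ((u x)\<^sup>2) \<partial>M)"
    using u2 by (subst nn_integral_eq_integral) auto
  finally show ?thesis .
qed simp

lemma subalgebra_sigma_of: "prX \<in> measurable P MX \<Longrightarrow> subalgebra P (sigma_of P prX MX)"
  unfolding subalgebra_def sigma_of_def by (simp add: sets_image_in_sets)

lemma subalgebra_sigma_of_compose:
  assumes prX: "prX \<in> measurable P MX" and f: "f \<in> measurable MX N"
  shows "subalgebra (sigma_of P prX MX) (sigma_of P (\<lambda>z. f (prX z)) N)"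
proof -
  have "prX \<in> measurable (vimage_algebra (space P) prX MX) MX"
    using measurable_space[OF prX] by (intro measurable_vimage_algebra1) auto
  from measurable_compose[OF this f] show ?thesis
    unfolding subalgebra_def sigma_of_def by (simp add: sets_image_in_sets)
qed

text \<open>By the tower property both calibration errors are \<open>L^2\<close> norms of the
  projections of \<open>m \<theta> f\<close> and \<open>m \<theta> g\<close> onto the information in
  \<theta>(X). The projection is linear and contracts the norm, so the triangle inequality
  applies.\<close>

lemma Cal_le_esqrt_diff_add_Cal:
  assumes P: "prob_space P" and prX: "prX \<in> measurable P MX"
    and \<theta>: "admissible P MX prX l G \<theta>" and m: "cond_exp_versions P MX prX l G m"
    and f: "f \<in> G" and g: "g \<in> G"
  shows "Cal P prX l \<theta> f \<le>
    esqrt (\<integral>\<^sup>+x. ennreal ((m \<theta> g x - m \<theta> f x)\<^sup>2) \<partial>distr P MX prX) + Cal P prX l \<theta> g"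
proof -
  interpret prob_space P by fact
  let ?X = "sigma_of P prX MX" and ?H = "sigma_of P (\<lambda>z. \<theta> (prX z)) borel"
  have \<theta>_meas: "\<theta> \<in> borel_measurable MX"
    and int: "\<And>f. f \<in> G \<Longrightarrow> integrable P (dloss l prX \<theta> f)"
    using \<theta> by (auto simp: admissible_def)
  have m_meas: "\<And>f. f \<in> G \<Longrightarrow> m \<theta> f \<in> borel_measurable MX"
    and m_ae: "\<And>f. f \<in> G \<Longrightarrow> AE z in P. m \<theta> f (prX z) = real_cond_exp P ?X (dloss l prX \<theta> f) z"
    using m \<theta> by (auto simp: cond_exp_versions_def)
  note [measurable] = prX m_meas[OF f] m_meas[OF g]
  have X: "subalgebra P ?X" by (rule subalgebra_sigma_of[OF prX])
  have XH: "subalgebra ?X ?H" by (rule subalgebra_sigma_of_compose[OF prX \<theta>_meas])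
  have PH: "subalgebra P ?H"
    by (rule subalgebra_sigma_of[OF measurable_compose[OF prX \<theta>_meas]])
  interpret X: finite_measure_subalgebra P ?X by unfold_locales (rule X)
  interpret H: finite_measure_subalgebra P ?H by unfold_locales (rule PH)
  have [measurable]: "real_cond_exp P ?H v \<in> borel_measurable P" for v
    by (rule measurable_from_subalg[OF PH]) (rule borel_measurable_cond_exp)
  have m_int: "integrable P (\<lambda>z. m \<theta> h (prX z))" if "h \<in> G" for h
  proof -
    have "integrable P (real_cond_exp P ?X (dloss l prX \<theta> h))"
      by (rule X.real_cond_exp_int(1)[OF int[OF that]])
    then show ?thesis
      by (rule integrable_cong_AE_imp)
        (use m_ae[OF that] m_meas[OF that] prX in \<open>auto intro: measurable_compose\<close>)
  qed
  \<comment> \<open>Conditioning on \<theta>(X) factors through conditioning on X. For a single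
    nuisance \<open>h\<close> any version serves, since versions agree almost everywhere.\<close>
  have tower: "AE z in P. real_cond_exp P ?H (dloss l prX \<theta> h) z =
      real_cond_exp P ?H (\<lambda>z. m \<theta> h (prX z)) z" if "h \<in> G" for h
  proof -
    have "AE z in P. real_cond_exp P ?H (real_cond_exp P ?X (dloss l prX \<theta> h)) z =
        real_cond_exp P ?H (dloss l prX \<theta> h) z"
      by (rule H.real_cond_exp_nested_subalg[OF X XH int[OF that]])
    moreover have "AE z in P. real_cond_exp P ?H (\<lambda>z. m \<theta> h (prX z)) z =
        real_cond_exp P ?H (real_cond_exp P ?X (dloss l prX \<theta> h)) z"
      by (rule H.real_cond_exp_cong[OF m_ae[OF that]])
        (use m_int[OF that] in \<open>auto intro: borel_measurable_integrable\<close>)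
    ultimately show ?thesis by eventually_elim simp
  qed
  let ?u = "\<lambda>z. m \<theta> g (prX z) - m \<theta> f (prX z)"
  have u_int: "integrable P ?u" using m_int f g by auto
  have "AE z in P. real_cond_exp P ?H ?u z =
      real_cond_exp P ?H (\<lambda>z. m \<theta> g (prX z)) z - real_cond_exp P ?H (\<lambda>z. m \<theta> f (prX z)) z"
    by (rule H.real_cond_exp_diff[OF m_int[OF g] m_int[OF f]])
  with tower[OF f] tower[OF g]
  have "AE z in P. ennreal ((real_cond_exp P ?H (dloss l prX \<theta> f) z)\<^sup>2) \<le>
     (ennreal \<bar>real_cond_exp P ?H ?u z\<bar> + ennreal \<bar>real_cond_exp P ?H (dloss l prX \<theta> g) z\<bar>)\<^sup>2"
  proof eventually_elim
    case (elim z)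
    let ?a = "real_cond_exp P ?H (dloss l prX \<theta> f) z" and ?b = "real_cond_exp P ?H (dloss l prX \<theta> g) z"
      and ?c = "real_cond_exp P ?H ?u z"
    have "\<bar>?a\<bar> \<le> \<bar>?c\<bar> + \<bar>?b\<bar>" using elim by linarith
    then have "?a\<^sup>2 \<le> (\<bar>?c\<bar> + \<bar>?b\<bar>)\<^sup>2"
      using power_mono[of "\<bar>?a\<bar>" _ 2] by simp
    then show ?case
      by (simp add: ennreal_power flip: ennreal_plus)
  qed
  then have "(\<integral>\<^sup>+z. ennreal ((real_cond_exp P ?H (dloss l prX \<theta> f) z)\<^sup>2) \<partial>P) \<le>
     (\<integral>\<^sup>+z. (ennreal \<bar>real_cond_exp P ?H ?u z\<bar> + ennreal \<bar>real_cond_exp P ?H (dloss l prX \<theta> g) z\<bar>)\<^sup>2 \<partial>P)"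
    by (rule nn_integral_mono_AE)
  also have "\<dots> = (esqrt \<dots>)\<^sup>2" by (simp add: esqrt_power2)
  finally have "Cal P prX l \<theta> f \<le> esqrt
     (\<integral>\<^sup>+z. (ennreal \<bar>real_cond_exp P ?H ?u z\<bar> + ennreal \<bar>real_cond_exp P ?H (dloss l prX \<theta> g) z\<bar>)\<^sup>2 \<partial>P)"
    by (simp add: Cal_def esqrt_le_iff)
  also have "\<dots> \<le> esqrt (\<integral>\<^sup>+z. (ennreal \<bar>real_cond_exp P ?H ?u z\<bar>)\<^sup>2 \<partial>P)
     + esqrt (\<integral>\<^sup>+z. (ennreal \<bar>real_cond_exp P ?H (dloss l prX \<theta> g) z\<bar>)\<^sup>2 \<partial>P)"
    by (rule Minkowski_nn_integral_esqrt) measurable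
  also have "esqrt (\<integral>\<^sup>+z. (ennreal \<bar>real_cond_exp P ?H (dloss l prX \<theta> g) z\<bar>)\<^sup>2 \<partial>P) = Cal P prX l \<theta> g"
    by (simp add: Cal_def ennreal_power)
  also have "esqrt (\<integral>\<^sup>+z. (ennreal \<bar>real_cond_exp P ?H ?u z\<bar>)\<^sup>2 \<partial>P) \<le> esqrt (\<integral>\<^sup>+z. ennreal ((?u z)\<^sup>2) \<partial>P)"
    using H.nn_integral_real_cond_exp_power2_le[OF u_int]
    by (simp add: esqrt_le_iff esqrt_power2 ennreal_power)
  also have "(\<integral>\<^sup>+z. ennreal ((?u z)\<^sup>2) \<partial>P) =
      (\<integral>\<^sup>+x. ennreal ((m \<theta> g x - m \<theta> f x)\<^sup>2) \<partial>distr P MX prX)"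
    by (simp add: nn_integral_distr)
  finally show ?thesis by (simp add: add_right_mono)
qed

section \<open>Gateaux derivatives along a line\<close>

lemma shift_shift: "shift (shift f h t) h s = shift f h (t + s)"
  by (auto simp: shift_def scaleR_add_left)

lemma shift_uminus: "shift f (- h) s = shift f h (- s)"
  by (auto simp: shift_def)

lemma has_real_derivative_compose_add:
  "((\<lambda>s. f (t + s)) has_real_derivative D) (at s) \<longleftrightarrow> (f has_real_derivative D) (at (t + s))"
  for f :: "real \<Rightarrow> real"
  using DERIV_shift[of f D s t] by (simp add: add.commute)

text \<open>Existence at a point of the line becomes ordinary twofold differentiability of the
  one-variable function \<open>F\<close>. The reversed direction is included because the nuisance
  error differentiates along \<open>g0 - g\<close>, while the path runs along \<open>g - g0\<close>;
  a second derivative is even in its direction.\<close>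

lemma gateaux2_exists_on_line:
  fixes T :: "('w \<Rightarrow> real ^ 'd) \<Rightarrow> real"
  assumes "gateaux2_exists T (shift f h t) h"
  defines "F \<equiv> \<lambda>s. T (shift f h s)"
  shows "(F has_real_derivative deriv F t) (at t)"
    and "(deriv F has_real_derivative deriv (deriv F) t) (at t)"
    and "gateaux2 T (shift f h t) (- h) = deriv (deriv F) t"
proof -
  have F_shift: "(\<lambda>s. T (shift (shift f h t) h s)) = (\<lambda>s. F (t + s))"
    by (simp add: F_def shift_shift)
  have F_deriv: "(F has_real_derivative deriv F r) (at r)" if "F field_differentiable at r" for r
    using that DERIV_deriv_iff_field_differentiable by blast
  have "\<forall>\<^sub>F s in nhds 0. F field_differentiable at (t + s)"
    using assms(1) unfolding gateaux2_exists_def F_shift field_differentiable_def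
    by (simp add: has_real_derivative_compose_add)
  then obtain e where e: "e > 0" "\<And>s. \<bar>s\<bar> < e \<Longrightarrow> F field_differentiable at (t + s)"
    by (auto simp: eventually_nhds_metric dist_real_def)
  show "(F has_real_derivative deriv F t) (at t)"
    using e(2)[of 0] e(1) F_deriv by simp
  \<comment> \<open>This holds even where \<open>F\<close> is not differentiable: the predicates
    from which \<open>deriv\<close> selects a value are equivalent.\<close>
  have "deriv (\<lambda>s. F (t + s)) = (\<lambda>s. deriv F (t + s))"
    unfolding deriv_def by (simp add: has_real_derivative_compose_add)
  then have "(\<lambda>s. deriv F (t + s)) field_differentiable at 0"
    using assms(1) unfolding gateaux2_exists_def F_shift by simp
  then have "deriv F field_differentiable at t"
    unfolding field_differentiable_def by (simp add: has_real_derivative_compose_add)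
  then show F2: "(deriv F has_real_derivative deriv (deriv F) t) (at t)"
    using DERIV_deriv_iff_field_differentiable by blast
  have F_neg: "(\<lambda>s. T (shift (shift f h t) (- h) s)) = (\<lambda>s. F (t - s))"
    by (simp add: F_def shift_shift shift_uminus)
  have reflect: "((\<lambda>s. t - s) has_real_derivative - 1) (at s)" for s :: real
    by (auto intro!: derivative_eq_intros)
  \<comment> \<open>Unlike translation, the sign change needs actual differentiability, so the
    identity is proved only near 0; that suffices to differentiate once more at 0.\<close>
  have deriv_neg: "deriv (\<lambda>s. F (t - s)) s = - deriv F (t - s)" if "\<bar>s\<bar> < e" for s
  proof (rule DERIV_imp_deriv)
    have "(F has_real_derivative deriv F (t - s)) (at (t - s))"
      using e(2)[of "- s"] that F_deriv by simp
    then show "((\<lambda>s. F (t - s)) has_real_derivative - deriv F (t - s)) (at s)"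
      using DERIV_chain2[of F "deriv F (t - s)" "\<lambda>s. t - s" s "- 1" UNIV] reflect by simp
  qed
  have "((\<lambda>s. - deriv F (t - s)) has_real_derivative deriv (deriv F) t) (at 0)"
    using DERIV_minus[OF DERIV_chain2[of "deriv F" "deriv (deriv F) t" "\<lambda>s. t - s" 0 "- 1" UNIV]]
      F2 reflect by simp
  then have "(deriv (\<lambda>s. F (t - s)) has_real_derivative deriv (deriv F) t) (at 0)"
    by (rule has_field_derivative_transform_within_open[of _ _ _ "{-e<..<e}"])
      (use e(1) deriv_neg in auto)
  then show "gateaux2 T (shift f h t) (- h) = deriv (deriv F) t"
    unfolding gateaux2_def F_neg by (rule DERIV_imp_deriv)
qed

text \<open>The constant weight \<open>t\<close> is a witness, as
  \<open>g0 + t (g - g0) = t g + (1 - t) g0\<close>.\<close>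

lemma shift_mem_nuisance_interval:
  assumes "t \<in> {0..1}"
  shows "shift g0 (g - g0) t \<in> nuisance_interval MW g g0"
  unfolding nuisance_interval_def
  by (rule CollectI, rule exI[of _ "\<lambda>_. t"]) (use assms in \<open>auto simp: shift_def algebra_simps\<close>)

section \<open>The bound along the segment from \<open>g0\<close> to \<open>g\<close>\<close>

theorem theorem3p3:
  fixes PZ :: "'z measure" and MX :: "'x measure" and MW :: "'w measure"
    and prX :: "'z \<Rightarrow> 'x" and prW :: "'z \<Rightarrow> 'w" and prWX :: "'w \<Rightarrow> 'x"
    and l :: "real \<Rightarrow> ('w \<Rightarrow> real ^ 'd) \<Rightarrow> 'z \<Rightarrow> real"
    and G :: "('w \<Rightarrow> real ^ 'd) set"
    and g0 g :: "'w \<Rightarrow> real ^ 'd"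
    and m :: "('x \<Rightarrow> real) \<Rightarrow> ('w \<Rightarrow> real ^ 'd) \<Rightarrow> 'x \<Rightarrow> real"
    and \<theta> :: "'x \<Rightarrow> real"
  assumes "prob_space PZ"
    and "prW \<in> measurable PZ MW"
    and "prWX \<in> measurable MW MX"
    and "prX \<in> measurable PZ MX"
    and "\<And>z. z \<in> space PZ \<Longrightarrow> prX z = prWX (prW z)"
    and "G \<subseteq> L2_functions (distr PZ MW prW)"
    and "g0 \<in> G"
    and "\<And>g. g \<in> G \<Longrightarrow> nuisance_interval MW g g0 \<subseteq> G"
    and "cond_exp_versions PZ MX prX l G m"
    and "universally_orthogonal PZ MX prX l G m g0"
    and "admissible PZ MX prX l G \<theta>"
    and "\<And>f g. f \<in> G \<Longrightarrow> g \<in> G \<Longrightarrow>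
           cond_gateaux2_exists (distr PZ MX prX) G m \<theta> f (g - g0)"
    and "g \<in> G"
  shows "Cal PZ prX l \<theta> g0 \<le> ennreal (1/2) * err (distr PZ MX prX) MW m g g0 \<theta> + Cal PZ prX l \<theta> g"
proof -
  note PZ = assms(1) and prX = assms(4) and g0 = assms(7) and interval = assms(8)
    and m = assms(9) and orth = assms(10) and adm = assms(11) and second = assms(12) and g = assms(13)
  interpret prob_space PZ by fact
  interpret PX: prob_space "distr PZ MX prX" by (rule prob_space_distr[OF prX])
  let ?h = "g - g0" and ?E = "err (distr PZ MX prX) MW m g g0 \<theta>"
  define \<phi> where "\<phi> t x = m \<theta> (shift g0 ?h t) x" for t x
  define \<phi>' where "\<phi>' t x = deriv (\<lambda>s. \<phi> s x) t" for t x
  define \<phi>'' where "\<phi>'' t x = deriv (\<lambda>s. \<phi>' s x) t" for t x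
  have line_in: "shift g0 ?h t \<in> G" if "t \<in> {0..1}" for t
    using shift_mem_nuisance_interval[OF that] interval[OF g] by blast
  have ends: "\<phi> 0 = m \<theta> g0" "\<phi> 1 = m \<theta> g"
    by (auto simp: \<phi>_def shift_def)
  \<comment> \<open>One null set serves all \<open>t\<close>, so for almost every \<open>x\<close>
    the whole path is twice differentiable, with two-sided derivatives at the ends.\<close>
  have "AE x in distr PZ MX prX. \<forall>t\<in>{0..1}. gateaux2_exists (\<lambda>f. m \<theta> f x) (shift g0 ?h t) ?h"
    using second[OF g0 g] line_in unfolding cond_gateaux2_exists_def by (auto elim: eventually_mono)
  then have reg: "AE x in distr PZ MX prX. \<forall>t\<in>{0..1}.
      ((\<lambda>s. \<phi> s x) has_real_derivative \<phi>' t x) (at t) \<and>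
      ((\<lambda>s. \<phi>' s x) has_real_derivative \<phi>'' t x) (at t) \<and>
      gateaux2 (\<lambda>f. m \<theta> f x) (shift g0 ?h t) (g0 - g) = \<phi>'' t x"
  proof eventually_elim
    case (elim x)
    have "g0 - g = - ?h" by (simp add: fun_eq_iff)
    then show ?case
      using gateaux2_exists_on_line[OF elim[rule_format]]
      unfolding \<phi>''_def \<phi>'_def \<phi>_def by simp
  qed
  have "AE x in distr PZ MX prX. has_gateaux_derivative (\<lambda>f. m \<theta> f x) 0 g0 ?h"
    using orth adm g by (auto simp: universally_orthogonal_def)
  \<comment> \<open>Orthogonality says precisely that the path has derivative 0 at
    \<open>t = 0\<close>, which removes the first-order Taylor term.\<close>
  then have orth0: "AE x in distr PZ MX prX. \<phi>' 0 x = 0"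
    by eventually_elim (simp add: has_gateaux_derivative_def \<phi>'_def \<phi>_def DERIV_imp_deriv)
  have "(\<integral>\<^sup>+x. ennreal ((\<phi> 1 x - \<phi> 0 x)\<^sup>2) \<partial>distr PZ MX prX) \<le> ennreal (1/4) * ?E\<^sup>2"
  proof (rule nn_integral_increment_le_second_derivative)
    show "sigma_finite_measure (distr PZ MX prX)"
      by (rule PX.sigma_finite_measure_axioms)
    show "\<phi> t \<in> borel_measurable (distr PZ MX prX)" if "t \<in> {0..1}" for t
      using m adm line_in[OF that] by (auto simp: cond_exp_versions_def \<phi>_def[abs_def])
    show "AE x in distr PZ MX prX. \<phi>' 0 x = 0 \<and>
        (\<forall>t\<in>{0..1}. ((\<lambda>s. \<phi> s x) has_real_derivative \<phi>' t x) (at t) \<and>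
                     ((\<lambda>s. \<phi>' s x) has_real_derivative \<phi>'' t x) (at t))"
      using reg orth0 by eventually_elim auto
    fix t :: real
    assume t: "t \<in> {0..1}"
    have "(\<integral>\<^sup>+x. ennreal ((\<phi>'' t x)\<^sup>2) \<partial>distr PZ MX prX) =
      (\<integral>\<^sup>+x. ennreal ((gateaux2 (\<lambda>f. m \<theta> f x) (shift g0 ?h t) (g0 - g))\<^sup>2) \<partial>distr PZ MX prX)"
      using reg t by (intro nn_integral_cong_AE) (auto elim!: eventually_mono)
    \<comment> \<open>Each point of the segment is one of the interpolants over which the nuisance
      error takes its supremum.\<close>
    also have "esqrt \<dots> \<le> ?E"
      unfolding err_def using shift_mem_nuisance_interval[OF t] by (rule SUP_upper)
    finally show "(\<integral>\<^sup>+x. ennreal ((\<phi>'' t x)\<^sup>2) \<partial>distr PZ MX prX) \<le> ?E\<^sup>2"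
      by (simp add: esqrt_le_iff)
  qed
  also have "\<dots> = (ennreal (1/2) * ?E)\<^sup>2"
    by (subst power_mult_distrib, subst ennreal_power) (simp_all add: power2_eq_square)
  finally have "esqrt (\<integral>\<^sup>+x. ennreal ((m \<theta> g x - m \<theta> g0 x)\<^sup>2) \<partial>distr PZ MX prX) \<le> ennreal (1/2) * ?E"
    by (simp only: esqrt_le_iff ends)
  then show ?thesis
    using Cal_le_esqrt_diff_add_Cal[OF PZ prX adm m g0 g] by (meson add_right_mono order_trans)
qed

end
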